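(* If a Latin square $L$ of order $n \geq 5$ has a transversal, then every entry of $L$ belongs to some minimal $(n+1)$-cover of $L$.
   Context: A Latin square of order $n$ is an $n\times n$ array on $n$ symbols in which each symbol occurs once in each row and each column; its entries are the triples $(i,j,L_{ij})$. A line is the set of all entries in a given row, in a given column, or with a given symbol. A transversal is a set of $n$ entries meeting every line exactly once. A cover is a set of entries meeting every line; an $(n+1)$-cover is a cover of size $n+1$; a cover $\mathscr{C}$ is minimal if $\mathscr{C}\setminus\{\mathbf{e}\}$ is not a cover for all $\mathbf{e}\in\mathscr{C}$. *)

theory Defs
  imports Main
begin

text \<open>Rows and columns are indexed by \<open>{..<n}\<close>; the \<open>n\<close> symbols form an arbitrary set \<open>S\<close>.
  The values \<open>L i j\<close> outside the index range are irrelevant.\<close>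

definition latin_square :: "nat \<Rightarrow> 'a set \<Rightarrow> (nat \<Rightarrow> nat \<Rightarrow> 'a) \<Rightarrow> bool" where
  "latin_square n S L \<longleftrightarrow>
     finite S \<and> card S = n \<and>
     (\<forall>i<n. \<forall>j<n. L i j \<in> S) \<and>
     (\<forall>i<n. \<forall>s\<in>S. \<exists>!j. j < n \<and> L i j = s) \<and>
     (\<forall>j<n. \<forall>s\<in>S. \<exists>!i. i < n \<and> L i j = s)"

definition entries :: "nat \<Rightarrow> (nat \<Rightarrow> nat \<Rightarrow> 'a) \<Rightarrow> (nat \<times> nat \<times> 'a) set" where
  "entries n L = {(i, j, L i j) | i j. i < n \<and> j < n}"

definition row_line :: "nat \<Rightarrow> (nat \<Rightarrow> nat \<Rightarrow> 'a) \<Rightarrow> nat \<Rightarrow> (nat \<times> nat \<times> 'a) set" where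
  "row_line n L r = {(i, j, s) \<in> entries n L. i = r}"

definition column_line :: "nat \<Rightarrow> (nat \<Rightarrow> nat \<Rightarrow> 'a) \<Rightarrow> nat \<Rightarrow> (nat \<times> nat \<times> 'a) set" where
  "column_line n L c = {(i, j, s) \<in> entries n L. j = c}"

definition symbol_line :: "nat \<Rightarrow> (nat \<Rightarrow> nat \<Rightarrow> 'a) \<Rightarrow> 'a \<Rightarrow> (nat \<times> nat \<times> 'a) set" where
  "symbol_line n L t = {(i, j, s) \<in> entries n L. s = t}"

definition lines :: "nat \<Rightarrow> 'a set \<Rightarrow> (nat \<Rightarrow> nat \<Rightarrow> 'a) \<Rightarrow> (nat \<times> nat \<times> 'a) set set" where
  "lines n S L = row_line n L ` {..<n} \<union> column_line n L ` {..<n} \<union> symbol_line n L ` S"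

definition transversal ::
  "nat \<Rightarrow> 'a set \<Rightarrow> (nat \<Rightarrow> nat \<Rightarrow> 'a) \<Rightarrow> (nat \<times> nat \<times> 'a) set \<Rightarrow> bool" where
  "transversal n S L T \<longleftrightarrow>
     T \<subseteq> entries n L \<and> card T = n \<and> (\<forall>l\<in>lines n S L. \<exists>!e. e \<in> T \<inter> l)"

definition cover ::
  "nat \<Rightarrow> 'a set \<Rightarrow> (nat \<Rightarrow> nat \<Rightarrow> 'a) \<Rightarrow> (nat \<times> nat \<times> 'a) set \<Rightarrow> bool" where
  "cover n S L C \<longleftrightarrow> C \<subseteq> entries n L \<and> (\<forall>l\<in>lines n S L. C \<inter> l \<noteq> {})"

definition k_cover ::
  "nat \<Rightarrow> 'a set \<Rightarrow> (nat \<Rightarrow> nat \<Rightarrow> 'a) \<Rightarrow> nat \<Rightarrow> (nat \<times> nat \<times> 'a) set \<Rightarrow> bool" where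
  "k_cover n S L k C \<longleftrightarrow> cover n S L C \<and> card C = k"

definition minimal_cover ::
  "nat \<Rightarrow> 'a set \<Rightarrow> (nat \<Rightarrow> nat \<Rightarrow> 'a) \<Rightarrow> (nat \<times> nat \<times> 'a) set \<Rightarrow> bool" where
  "minimal_cover n S L C \<longleftrightarrow> cover n S L C \<and> (\<forall>e\<in>C. \<not> cover n S L (C - {e}))"

end

theory Submission
  imports Defs
begin

text \<open>
  Deleting two entries \<open>(r\<^sub>1, c\<^sub>1, s\<^sub>1)\<close>, \<open>(r\<^sub>2, c\<^sub>2, s\<^sub>2)\<close> of a transversal \<open>T\<close> uncovers six
  lines, which are covered again by the entries \<open>(r\<^sub>1, c\<^sub>2, x)\<close>, \<open>(r\<^sub>2, y, s\<^sub>1)\<close>, \<open>(z, c\<^sub>1, s\<^sub>2)\<close>. The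
  resulting cover of size \<open>n + 1\<close> is minimal unless \<open>(z, y, x) \<in> T\<close>; in that exceptional case,
  replacing the three entries of \<open>T\<close> by the three new ones gives another transversal. Hence an
  entry outside \<open>T\<close> lies in a minimal cover or in another transversal, so we may assume \<open>e \<in> T\<close>.

  Write \<open>a * b\<close> for the entry of \<open>T\<close> whose symbol is in the row of \<open>a\<close> and the column of \<open>b\<close>. If
  every pair in \<open>T - {e}\<close> is exceptional, choose \<open>a\<close> and \<open>d\<close> with \<open>a * d = e\<close>, then \<open>b\<close> outside
  \<open>{e, a, d}\<close> with \<open>c = a * b \<noteq> d\<close>. After trading \<open>a, b, c\<close>, the pair formed by the new entry in
  the row of \<open>c\<close> and by \<open>d\<close> is no longer exceptional.
\<close>

section \<open>Latin squares, covers and transversals in coordinates\<close>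

lemma latin_squareD:
  assumes "latin_square n S L"
  shows "\<And>i j. i < n \<Longrightarrow> j < n \<Longrightarrow> L i j \<in> S"
    and "\<And>i s. i < n \<Longrightarrow> s \<in> S \<Longrightarrow> \<exists>j<n. L i j = s"
    and "\<And>j s. j < n \<Longrightarrow> s \<in> S \<Longrightarrow> \<exists>i<n. L i j = s"
    and "\<And>i j j'. i < n \<Longrightarrow> j < n \<Longrightarrow> j' < n \<Longrightarrow> L i j = L i j' \<Longrightarrow> j = j'"
    and "\<And>i i' j. i < n \<Longrightarrow> i' < n \<Longrightarrow> j < n \<Longrightarrow> L i j = L i' j \<Longrightarrow> i = i'"
  using assms unfolding latin_square_def by metis+

lemma cover_iff:
  "cover n S L C \<longleftrightarrow> C \<subseteq> entries n L \<and>
     (\<forall>r<n. \<exists>c s. (r, c, s) \<in> C) \<and> (\<forall>c<n. \<exists>r s. (r, c, s) \<in> C) \<and> (\<forall>s\<in>S. \<exists>r c. (r, c, s) \<in> C)"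
proof (cases "C \<subseteq> entries n L")
  case True
  then have "\<And>r. C \<inter> row_line n L r \<noteq> {} \<longleftrightarrow> (\<exists>c s. (r, c, s) \<in> C)"
    and "\<And>c. C \<inter> column_line n L c \<noteq> {} \<longleftrightarrow> (\<exists>r s. (r, c, s) \<in> C)"
    and "\<And>s. C \<inter> symbol_line n L s \<noteq> {} \<longleftrightarrow> (\<exists>r c. (r, c, s) \<in> C)"
    unfolding row_line_def column_line_def symbol_line_def by auto
  then show ?thesis
    unfolding cover_def lines_def ball_Un ball_simps by (simp add: Ball_def)
qed (simp add: cover_def)

lemma mem_entriesD:
  assumes "(r, c, s) \<in> entries n L"
  shows "r < n" "c < n" "s = L r c"
  using assms unfolding entries_def by auto

lemma finite_entries: "finite (entries n L)"
proof -
  have "entries n L = (\<lambda>(i, j). (i, j, L i j)) ` ({..<n} \<times> {..<n})"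
    unfolding entries_def by auto
  then show ?thesis by simp
qed

lemma transversal_cover:
  assumes "transversal n S L T"
  shows "cover n S L T"
  using assms unfolding transversal_def cover_def by blast

lemma transversal_inj:
  assumes "latin_square n S L" "transversal n S L T" "(r, c, s) \<in> T" "(r', c', s') \<in> T"
    and "r = r' \<or> c = c' \<or> s = s'"
  shows "r = r' \<and> c = c' \<and> s = s'"
proof -
  have T: "T \<subseteq> entries n L" and one: "\<And>l. l \<in> lines n S L \<Longrightarrow> \<exists>!e. e \<in> T \<inter> l"
    using assms(2) unfolding transversal_def by auto
  note e = mem_entriesD[OF subsetD[OF T assms(3)]] and e' = mem_entriesD[OF subsetD[OF T assms(4)]]
  have "s \<in> S"
    using e latin_squareD(1)[OF assms(1)] by simp
  then have "row_line n L r \<in> lines n S L" "column_line n L c \<in> lines n S L"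
    "symbol_line n L s \<in> lines n S L"
    using e by (auto simp: lines_def)
  note this[THEN one]
  moreover have "r = r' \<Longrightarrow> (r, c, s) \<in> T \<inter> row_line n L r \<and> (r', c', s') \<in> T \<inter> row_line n L r"
    "c = c' \<Longrightarrow> (r, c, s) \<in> T \<inter> column_line n L c \<and> (r', c', s') \<in> T \<inter> column_line n L c"
    "s = s' \<Longrightarrow> (r, c, s) \<in> T \<inter> symbol_line n L s \<and> (r', c', s') \<in> T \<inter> symbol_line n L s"
    using assms(3,4) T unfolding row_line_def column_line_def symbol_line_def by auto
  ultimately have "(r, c, s) = (r', c', s')"
    using assms(5) by (metis (no_types, lifting))
  then show ?thesis by simp
qed

lemma transversal_neq:
  assumes "latin_square n S L" "transversal n S L T" "(r, c, s) \<in> T" "(r', c', s') \<in> T"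
    and "(r, c, s) \<noteq> (r', c', s')"
  shows "r \<noteq> r'" "c \<noteq> c'" "s \<noteq> s'"
  using transversal_inj[OF assms(1-4)] assms(5) by blast+

section \<open>Transversals as covers of size \<open>n\<close>\<close>

lemma inj_on_if_covering:
  assumes "finite T" "card T = card A" "A \<subseteq> f ` T"
  shows "inj_on f T"
proof (rule eq_card_imp_inj_on)
  show "card (f ` T) = card T"
    using assms card_image_le[of T f] card_mono[of "f ` T" A] by simp
qed (fact assms(1))

text \<open>By pigeonhole, \<open>n\<close> entries covering all \<open>n\<close> rows, columns and
  symbols have injective coordinate projections, so no line is met twice.\<close>

lemma transversalI:
  assumes "latin_square n S L" "k_cover n S L n T"
  shows "transversal n S L T"
proof -
  have C: "cover n S L T" and card: "card T = n"
    using assms(2) unfolding k_cover_def by auto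
  have T: "T \<subseteq> entries n L"
    using C unfolding cover_def by simp
  then have "finite T"
    using finite_entries finite_subset by blast
  moreover have "card S = n"
    using assms(1) unfolding latin_square_def by simp
  moreover have "{..<n} \<subseteq> fst ` T" "{..<n} \<subseteq> (\<lambda>e. fst (snd e)) ` T" "S \<subseteq> (\<lambda>e. snd (snd e)) ` T"
    using C unfolding cover_iff by (force simp: image_iff)+
  ultimately have inj: "inj_on fst T" "inj_on (\<lambda>e. fst (snd e)) T" "inj_on (\<lambda>e. snd (snd e)) T"
    using card inj_on_if_covering[of T "{..<n}"] inj_on_if_covering[of T S] by simp_all
  have "e = e'" if l: "l \<in> lines n S L" and e: "e \<in> T \<inter> l" "e' \<in> T \<inter> l" for l e e'
  proof -
    have "fst e = fst e' \<or> fst (snd e) = fst (snd e') \<or> snd (snd e) = snd (snd e')"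
      using l e unfolding lines_def row_line_def column_line_def symbol_line_def by auto
    then show ?thesis
      using e inj by (metis IntD1 inj_onD)
  qed
  moreover have "T \<inter> l \<noteq> {}" if "l \<in> lines n S L" for l
    using C that unfolding cover_def by blast
  ultimately show ?thesis
    using T card unfolding transversal_def by blast
qed

section \<open>Exchanging entries of a transversal\<close>

text \<open>The old and the new triple occupy the same nine lines, so size and covering are
  preserved, and a cover by \<open>n\<close> entries is a transversal.\<close>

lemma transversal_trade:
  assumes latin: "latin_square n S L" and T: "transversal n S L T"
    and t: "(r\<^sub>1, c\<^sub>1, s\<^sub>1) \<in> T" "(r\<^sub>2, c\<^sub>2, s\<^sub>2) \<in> T" "(r\<^sub>3, c\<^sub>3, s\<^sub>3) \<in> T" and "r\<^sub>1 \<noteq> r\<^sub>2"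
    and bad: "L r\<^sub>1 c\<^sub>2 = s\<^sub>3" "L r\<^sub>2 c\<^sub>3 = s\<^sub>1" "L r\<^sub>3 c\<^sub>1 = s\<^sub>2"
  shows "transversal n S L (T - {(r\<^sub>1, c\<^sub>1, s\<^sub>1), (r\<^sub>2, c\<^sub>2, s\<^sub>2), (r\<^sub>3, c\<^sub>3, s\<^sub>3)}
           \<union> {(r\<^sub>1, c\<^sub>2, s\<^sub>3), (r\<^sub>2, c\<^sub>3, s\<^sub>1), (r\<^sub>3, c\<^sub>1, s\<^sub>2)})"
    (is "transversal n S L (T - ?A \<union> ?B)")
proof -
  note inj = transversal_inj[OF latin T]
  have C: "cover n S L T"
    using T by (rule transversal_cover)
  then have TE: "T \<subseteq> entries n L"
    unfolding cover_def by simp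
  note e = mem_entriesD[OF subsetD[OF TE t(1)]] mem_entriesD[OF subsetD[OF TE t(2)]]
    mem_entriesD[OF subsetD[OF TE t(3)]]
  have c12: "c\<^sub>1 \<noteq> c\<^sub>2" "s\<^sub>1 \<noteq> s\<^sub>2"
    using inj[OF t(1,2)] \<open>r\<^sub>1 \<noteq> r\<^sub>2\<close> by auto
  \<comment> \<open>\<open>r\<^sub>3 = r\<^sub>1\<close> would force
    \<open>s\<^sub>1 = s\<^sub>2\<close>, and \<open>r\<^sub>3 = r\<^sub>2\<close> would put
    \<open>s\<^sub>2\<close> twice in row \<open>r\<^sub>2\<close>.\<close>
  have 31: "r\<^sub>3 \<noteq> r\<^sub>1"
    using bad(3) e(3) c12 by auto
  have 32: "r\<^sub>3 \<noteq> r\<^sub>2"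
    using bad(3) e c12 latin_squareD(4)[OF latin, of r\<^sub>2 c\<^sub>1 c\<^sub>2] by auto
  have A: "card ?A = 3" "?A \<subseteq> T" and B: "card ?B = 3"
    using \<open>r\<^sub>1 \<noteq> r\<^sub>2\<close> 31 32 t by auto
  \<comment> \<open>Each new entry shares its row with a removed one, so it cannot be among the kept
    entries of \<open>T\<close>.\<close>
  have disj: "?B \<inter> (T - ?A) = {}"
    using \<open>r\<^sub>1 \<noteq> r\<^sub>2\<close> 31 32 inj[OF _ t(1)] inj[OF _ t(2)] inj[OF _ t(3)] by blast
  have fin: "finite T"
    using TE finite_entries finite_subset by blast
  have "card T = n"
    using T unfolding transversal_def by simp
  moreover have "card (T - ?A) = card T - 3"
    using A card_Diff_subset[of ?A T] by simp
  moreover have "3 \<le> card T"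
    using A fin card_mono[of T ?A] by simp
  moreover have "card (T - ?A \<union> ?B) = card (T - ?A) + 3"
    using B fin disj card_Un_disjoint[of "T - ?A" ?B] by (simp add: Int_commute)
  ultimately have "card (T - ?A \<union> ?B) = n"
    by simp
  moreover have "cover n S L (T - ?A \<union> ?B)"
    unfolding cover_iff
  proof (intro conjI allI impI ballI)
    show "T - ?A \<union> ?B \<subseteq> entries n L"
      using TE e bad unfolding entries_def by auto
  next
    fix r assume "r < n"
    then obtain c s where "(r, c, s) \<in> T" using C unfolding cover_iff by blast
    then show "\<exists>c s. (r, c, s) \<in> T - ?A \<union> ?B" by blast
  next
    fix c assume "c < n"
    then obtain r s where "(r, c, s) \<in> T" using C unfolding cover_iff by blast
    then show "\<exists>r s. (r, c, s) \<in> T - ?A \<union> ?B" by blast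
  next
    fix s assume "s \<in> S"
    then obtain r c where "(r, c, s) \<in> T" using C unfolding cover_iff by blast
    then show "\<exists>r c. (r, c, s) \<in> T - ?A \<union> ?B" by blast
  qed
  ultimately show "transversal n S L (T - ?A \<union> ?B)"
    using latin transversalI unfolding k_cover_def by blast
qed

text \<open>Each new entry covers two of the six emptied lines; its third line (row
  \<open>z\<close>, column \<open>y\<close> or symbol \<open>L r\<^sub>1 c\<^sub>2\<close>) is then
  met twice. An entry is redundant only if all its lines are met twice, which \<open>good\<close>
  rules out.\<close>

lemma transversal_swap:
  assumes latin: "latin_square n S L" and T: "transversal n S L T"
    and t: "(r\<^sub>1, c\<^sub>1, s\<^sub>1) \<in> T" "(r\<^sub>2, c\<^sub>2, s\<^sub>2) \<in> T" and "r\<^sub>1 \<noteq> r\<^sub>2"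
    and y: "y < n" "L r\<^sub>2 y = s\<^sub>1" and z: "z < n" "L z c\<^sub>1 = s\<^sub>2"
    and good: "(z, y, L r\<^sub>1 c\<^sub>2) \<notin> T"
    and C_def: "C = T - {(r\<^sub>1, c\<^sub>1, s\<^sub>1), (r\<^sub>2, c\<^sub>2, s\<^sub>2)}
           \<union> {(r\<^sub>1, c\<^sub>2, L r\<^sub>1 c\<^sub>2), (r\<^sub>2, y, s\<^sub>1), (z, c\<^sub>1, s\<^sub>2)}"
  shows "k_cover n S L (n + 1) C \<and> minimal_cover n S L C"
proof -
  let ?A = "{(r\<^sub>1, c\<^sub>1, s\<^sub>1), (r\<^sub>2, c\<^sub>2, s\<^sub>2)}"
  let ?B = "{(r\<^sub>1, c\<^sub>2, L r\<^sub>1 c\<^sub>2), (r\<^sub>2, y, s\<^sub>1), (z, c\<^sub>1, s\<^sub>2)}"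
  note inj = transversal_inj[OF latin T]
  have CT: "cover n S L T"
    using T by (rule transversal_cover)
  then have TE: "T \<subseteq> entries n L"
    unfolding cover_def by simp
  note e = mem_entriesD[OF subsetD[OF TE t(1)]] mem_entriesD[OF subsetD[OF TE t(2)]]
  have ne: "c\<^sub>1 \<noteq> c\<^sub>2" "s\<^sub>1 \<noteq> s\<^sub>2"
    using inj[OF t(1,2)] \<open>r\<^sub>1 \<noteq> r\<^sub>2\<close> by auto
  \<comment> \<open>Row \<open>z\<close> and column \<open>y\<close> are not among the emptied
    lines: otherwise \<open>s\<^sub>1 = s\<^sub>2\<close>, \<open>c\<^sub>1 = c\<^sub>2\<close> or
    \<open>r\<^sub>1 = r\<^sub>2\<close> would follow.\<close>
  have z1: "z \<noteq> r\<^sub>1"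
    using z e ne by auto
  have z2: "z \<noteq> r\<^sub>2"
    using z e ne latin_squareD(4)[OF latin, of r\<^sub>2 c\<^sub>1 c\<^sub>2] by auto
  have y2: "y \<noteq> c\<^sub>2"
    using y e ne by auto
  have y1: "y \<noteq> c\<^sub>1"
    using y e \<open>r\<^sub>1 \<noteq> r\<^sub>2\<close> latin_squareD(5)[OF latin, of r\<^sub>1 r\<^sub>2 c\<^sub>1] by auto
  have fin: "finite T"
    using TE finite_entries finite_subset by blast
  have A: "card ?A = 2" "?A \<subseteq> T" and B: "card ?B = 3"
    using \<open>r\<^sub>1 \<noteq> r\<^sub>2\<close> z1 z2 t by auto
  have disj: "?B \<inter> (T - ?A) = {}"
    using \<open>r\<^sub>1 \<noteq> r\<^sub>2\<close> inj[OF _ t(1)] inj[OF _ t(2)] by blast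
  have "card T = n"
    using T unfolding transversal_def by simp
  moreover have "card (T - ?A) = card T - 2"
    using A card_Diff_subset[of ?A T] by simp
  moreover have "2 \<le> card T"
    using A fin card_mono[of T ?A] by simp
  moreover have "card C = card (T - ?A) + 3"
    using B fin disj card_Un_disjoint[of "T - ?A" ?B] unfolding C_def by (simp add: Int_commute)
  ultimately have card: "card C = n + 1"
    by simp
  have cover: "cover n S L C"
    unfolding cover_iff C_def
  proof (intro conjI allI impI ballI)
    show "T - ?A \<union> ?B \<subseteq> entries n L"
      using TE e y z unfolding entries_def by auto
  next
    fix r assume "r < n"
    then obtain c s where "(r, c, s) \<in> T" using CT unfolding cover_iff by blast
    then show "\<exists>c s. (r, c, s) \<in> T - ?A \<union> ?B" by blast
  next
    fix c assume "c < n"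
    then obtain r s where "(r, c, s) \<in> T" using CT unfolding cover_iff by blast
    then show "\<exists>r s. (r, c, s) \<in> T - ?A \<union> ?B" by blast
  next
    fix s assume "s \<in> S"
    then obtain r c where "(r, c, s) \<in> T" using CT unfolding cover_iff by blast
    then show "\<exists>r c. (r, c, s) \<in> T - ?A \<union> ?B" by blast
  qed
  have S: "s \<in> S" if "(r, c, s) \<in> C" for r c s
    using that cover latin_squareD(1)[OF latin] mem_entriesD[of r c s n L] unfolding cover_def by auto
  have "\<not> cover n S L (C - {(r, c, s)})" if "(r, c, s) \<in> C" for r c s
  proof -
    have bounds: "r < n" "c < n" "s \<in> S"
      using that cover S mem_entriesD[of r c s n L] unfolding cover_def by auto
    \<comment> \<open>Only row \<open>z\<close>, column \<open>y\<close> and symbol \<open>L r\<^sub>1 c\<^sub>2\<close> are covered twice.\<close>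
    have "(\<forall>c' s'. (r, c', s') \<notin> C - {(r, c, s)}) \<or> (\<forall>r' s'. (r', c, s') \<notin> C - {(r, c, s)})
        \<or> (\<forall>r' c'. (r', c', s) \<notin> C - {(r, c, s)})"
      using that[unfolded C_def]
    proof (elim UnE DiffE insertE emptyE)
      assume "(r, c, s) \<in> T" "(r, c, s) \<notin> ?A"
      then have "(r, c, s) \<noteq> (r\<^sub>1, c\<^sub>1, s\<^sub>1)" "(r, c, s) \<noteq> (r\<^sub>2, c\<^sub>2, s\<^sub>2)"
        by auto
      note ne' = transversal_neq[OF latin T \<open>(r, c, s) \<in> T\<close> t(1) this(1)]
        transversal_neq[OF latin T \<open>(r, c, s) \<in> T\<close> t(2) this(2)]
      note inj' = inj[OF \<open>(r, c, s) \<in> T\<close>]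
      \<comment> \<open>By \<open>good\<close>, a kept entry avoids one of the three doubly covered
        lines; its own line of that kind becomes uncovered.\<close>
      consider "r \<noteq> z" | "c \<noteq> y" | "s \<noteq> L r\<^sub>1 c\<^sub>2"
        using good \<open>(r, c, s) \<in> T\<close> by auto
      then show ?thesis
      proof cases
        case 1
        then have "(r, c', s') \<notin> C - {(r, c, s)}" for c' s'
          using ne' inj'[of r c' s'] unfolding C_def by auto
        then show ?thesis by blast
      next
        case 2
        then have "(r', c, s') \<notin> C - {(r, c, s)}" for r' s'
          using ne' inj'[of r' c s'] unfolding C_def by auto
        then show ?thesis by blast
      next
        case 3
        then have "(r', c', s) \<notin> C - {(r, c, s)}" for r' c'
          using ne' inj'[of r' c' s] unfolding C_def by auto
        then show ?thesis by blast
      qed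
    next
      assume "(r, c, s) = (r\<^sub>1, c\<^sub>2, L r\<^sub>1 c\<^sub>2)"
      then have "(r, c', s') \<notin> C - {(r, c, s)}" for c' s'
        using inj[OF _ t(1), of r c' s'] z1 \<open>r\<^sub>1 \<noteq> r\<^sub>2\<close> unfolding C_def by auto
      then show ?thesis by blast
    next
      assume "(r, c, s) = (r\<^sub>2, y, s\<^sub>1)"
      then have "(r, c', s') \<notin> C - {(r, c, s)}" for c' s'
        using inj[OF _ t(2), of r c' s'] z2 \<open>r\<^sub>1 \<noteq> r\<^sub>2\<close> unfolding C_def by auto
      then show ?thesis by blast
    next
      \<comment> \<open>The row \<open>z\<close> of this entry is met twice, so column
        \<open>c\<^sub>1\<close> is the witness here instead of a row.\<close>
      assume "(r, c, s) = (z, c\<^sub>1, s\<^sub>2)"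
      then have "(r', c, s') \<notin> C - {(r, c, s)}" for r' s'
        using inj[OF _ t(1), of r' c s'] y1 ne unfolding C_def by auto
      then show ?thesis by blast
    qed
    then show ?thesis
      using bounds unfolding cover_iff by (elim disjE) metis+
  qed
  then show ?thesis
    using cover card unfolding k_cover_def minimal_cover_def by auto
qed

text \<open>The alternative is whether \<open>(z, y, L r\<^sub>1 c\<^sub>2)\<close> lies in
  \<open>T\<close>. The swap case records what a cover gains, for entries outside \<open>T\<close>,
  and what it keeps, for entries of \<open>T\<close>.\<close>

lemma swap_or_trade:
  assumes latin: "latin_square n S L" and T: "transversal n S L T"
    and t: "(r\<^sub>1, c\<^sub>1, s\<^sub>1) \<in> T" "(r\<^sub>2, c\<^sub>2, s\<^sub>2) \<in> T" and "r\<^sub>1 \<noteq> r\<^sub>2"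
  obtains (swap) C where "k_cover n S L (n + 1) C" "minimal_cover n S L C"
      "(r\<^sub>1, c\<^sub>2, L r\<^sub>1 c\<^sub>2) \<in> C" "T - {(r\<^sub>1, c\<^sub>1, s\<^sub>1), (r\<^sub>2, c\<^sub>2, s\<^sub>2)} \<subseteq> C"
  | (trade) r\<^sub>3 c\<^sub>3 s\<^sub>3 where "(r\<^sub>3, c\<^sub>3, s\<^sub>3) \<in> T"
      "L r\<^sub>1 c\<^sub>2 = s\<^sub>3" "L r\<^sub>2 c\<^sub>3 = s\<^sub>1" "L r\<^sub>3 c\<^sub>1 = s\<^sub>2"
proof -
  have TE: "T \<subseteq> entries n L"
    using T unfolding transversal_def by simp
  note e = mem_entriesD[OF subsetD[OF TE t(1)]] mem_entriesD[OF subsetD[OF TE t(2)]]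
  obtain y where y: "y < n" "L r\<^sub>2 y = s\<^sub>1"
    using e latin_squareD(1,2)[OF latin] by metis
  obtain z where z: "z < n" "L z c\<^sub>1 = s\<^sub>2"
    using e latin_squareD(1,3)[OF latin] by metis
  show ?thesis
  proof (cases "(z, y, L r\<^sub>1 c\<^sub>2) \<in> T")
    case True
    then show ?thesis using y z trade by blast
  next
    case False
    from transversal_swap[OF latin T t \<open>r\<^sub>1 \<noteq> r\<^sub>2\<close> y z this refl] show ?thesis
      using swap by blast
  qed
qed

section \<open>Entries lying on a transversal\<close>

lemma minimal_cover_if_in_transversal:
  assumes latin: "latin_square n S L" and T: "transversal n S L T" and "n \<ge> 5" and "e \<in> T"
  shows "\<exists>C. k_cover n S L (n + 1) C \<and> minimal_cover n S L C \<and> e \<in> C"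
proof (rule ccontr)
  assume none: "\<not> ?thesis"
  note inj = transversal_inj[OF latin T] and neq = transversal_neq[OF latin T]
  have TE: "T \<subseteq> entries n L" and card: "card T \<ge> 5" and cover: "cover n S L T"
    using T \<open>n \<ge> 5\<close> transversal_cover unfolding transversal_def by auto
  have avoid: "\<exists>t\<in>T. t \<notin> set xs" if "length xs < 5" for xs
    using that card card_mono[of "set xs" T] card_length[of xs] by fastforce
  have in_row: "\<exists>r' c' s'. (r', c', s') \<in> T \<and> L r c' = s" if "r < n" "s \<in> S" for r s
    using latin_squareD(2)[OF latin that] cover unfolding cover_iff by metis
  \<comment> \<open>A swap of a pair avoiding \<open>e\<close> would keep \<open>e\<close>,
    contradicting \<open>none\<close>; so every such pair is exceptional.\<close>
  have bad: "\<exists>r'' c'' s''. (r'', c'', s'') \<in> T \<and> L r c' = s'' \<and> L r' c'' = s \<and> L r'' c = s'"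
    if t: "(r, c, s) \<in> T - {e}" "(r', c', s') \<in> T - {e}" and "r \<noteq> r'" for r c s r' c' s'
  proof -
    have "(r, c, s) \<in> T" "(r', c', s') \<in> T"
      using t by auto
    from latin T this \<open>r \<noteq> r'\<close> show ?thesis
      by (cases rule: swap_or_trade) (use none t \<open>e \<in> T\<close> in blast)+
  qed
  obtain re ce se where e: "e = (re, ce, se)"
    by (metis prod_cases3)
  obtain ra ca sa where a: "(ra, ca, sa) \<in> T" "(ra, ca, sa) \<noteq> e"
    using avoid[of "[e]"] by auto
  have eT: "(re, ce, se) \<in> T"
    using e \<open>e \<in> T\<close> by simp
  note ae = mem_entriesD[OF subsetD[OF TE a(1)]] mem_entriesD[OF subsetD[OF TE eT]]
  obtain rd cd sd where d: "(rd, cd, sd) \<in> T" "L ra cd = se"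
    using in_row[of ra se] ae latin_squareD(1)[OF latin] by blast
  note de = mem_entriesD[OF subsetD[OF TE d(1)]]
  \<comment> \<open>\<open>f\<close> solves \<open>a * f = d\<close>; choosing \<open>b\<close>
    different from \<open>f\<close> will give \<open>a * b \<noteq> d\<close>.\<close>
  obtain rf cf sf where f: "(rf, cf, sf) \<in> T" "L ra cf = sd"
    using in_row[of ra sd] ae de latin_squareD(1)[OF latin] by blast
  \<comment> \<open>At most four entries are excluded, so \<open>n \<ge> 5\<close> leaves a
    choice.\<close>
  obtain rb cb sb where b: "(rb, cb, sb) \<in> T"
    "(rb, cb, sb) \<notin> {e, (ra, ca, sa), (rd, cd, sd), (rf, cf, sf)}"
    using avoid[of "[e, (ra, ca, sa), (rd, cd, sd), (rf, cf, sf)]"] by auto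
  note be = mem_entriesD[OF subsetD[OF TE b(1)]]
  note ra = neq[OF a(1) eT a(2)[unfolded e]]
  have "(rb, cb, sb) \<noteq> (re, ce, se)" "(rb, cb, sb) \<noteq> (ra, ca, sa)"
    "(rb, cb, sb) \<noteq> (rd, cd, sd)" "(rb, cb, sb) \<noteq> (rf, cf, sf)"
    using b(2) unfolding e by blast+
  note rb = neq[OF b(1) eT this(1)] neq[OF b(1) a(1) this(2)] neq[OF b(1) d(1) this(3)]
    neq[OF b(1) f(1) this(4)]
  \<comment> \<open>\<open>d\<close> differs from \<open>e\<close> and \<open>a\<close>, since
    neither \<open>a * e\<close> nor \<open>a * a\<close> is \<open>e\<close>.\<close>
  have "cd \<noteq> ce"
    using d(2) ae ra latin_squareD(5)[OF latin, of ra re ce] by metis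
  then have rd: "rd \<noteq> re"
    using inj[OF d(1) eT] by blast
  have "cd \<noteq> ca"
    using d(2) ae ra by metis
  then have rda: "rd \<noteq> ra"
    using inj[OF d(1) a(1)] by blast
  obtain rc cc sc where c: "(rc, cc, sc) \<in> T" "L ra cb = sc" "L rb cc = sa" "L rc ca = sb"
    using bad[of ra ca sa rb cb sb] a b rb by blast
  note ce = mem_entriesD[OF subsetD[OF TE c(1)]]
  note fe = mem_entriesD[OF subsetD[OF TE f(1)]]
  \<comment> \<open>\<open>b\<close> differs from \<open>d\<close> and \<open>f\<close>, and row
    \<open>ra\<close> repeats no symbol, so \<open>c = a * b\<close> is neither
    \<open>e = a * d\<close> nor \<open>d = a * f\<close>.\<close>
  have "sc \<noteq> se"
    using c(2) d(2) rb ae be(2) de(2) latin_squareD(4)[OF latin, of ra cb cd] by metis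
  then have rc: "rc \<noteq> re"
    using inj[OF c(1) eT] by blast
  have "sc \<noteq> sd"
    using c(2) f(2) rb ae be(2) fe(2) latin_squareD(4)[OF latin, of ra cb cf] by metis
  then have rcd: "rc \<noteq> rd"
    using inj[OF c(1) d(1)] by blast
  \<comment> \<open>As \<open>a * d = e\<close>, the third entry of this exceptional triple is \<open>e\<close>.\<close>
  have z: "L re ca = sd"
  proof -
    obtain r c s where "(r, c, s) \<in> T" "L ra cd = s" "L r ca = sd"
      using bad[of ra ca sa rd cd sd] a d(1) e rd rda by blast
    then show ?thesis
      using inj[OF _ eT] d(2) by metis
  qed
  \<comment> \<open>The pair \<open>b\<close>, \<open>d\<close> locates \<open>sb\<close> in row
    \<open>rd\<close>. After the trade, \<open>sb\<close> is the symbol of the entry in row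
    \<open>rc\<close>, so \<open>cy\<close> is the column needed for swapping that entry with
    \<open>d\<close>.\<close>
  obtain ry cy sy where y: "(ry, cy, sy) \<in> T" "L rb cd = sy" "L rd cy = sb"
    using bad[of rb cb sb rd cd sd] b d(1) e rd rb by blast
  note ye = mem_entriesD[OF subsetD[OF TE y(1)]]
  \<comment> \<open>\<open>cy = ce\<close> would mean \<open>b * d = e = a * d\<close>, repeating
    \<open>se\<close> in column \<open>cd\<close>.\<close>
  have "sy \<noteq> se"
    using y(2) d(2) rb ae be(1) de(2) latin_squareD(5)[OF latin, of ra rb cd] by metis
  then have "cy \<noteq> ce"
    using inj[OF y(1) eT] by blast
  define T' where "T' = T - {(ra, ca, sa), (rb, cb, sb), (rc, cc, sc)}
           \<union> {(ra, cb, sc), (rb, cc, sa), (rc, ca, sb)}"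
  have T': "transversal n S L T'"
    unfolding T'_def using transversal_trade[OF latin T a(1) b(1) c(1) _ c(2-4)] rb by simp
  have mem: "(rc, ca, sb) \<in> T'" "(rd, cd, sd) \<in> T'" "e \<in> T'"
    using d(1) eT e ra rb rc rcd rd rda unfolding T'_def by auto
  \<comment> \<open>The only entry of \<open>T'\<close> in row \<open>re\<close> is
    \<open>e\<close>, whose column is not \<open>cy\<close>.\<close>
  have "(re, cy, L rc cd) \<notin> T'"
    using inj[OF _ eT, of re cy "L rc cd"] ra rb rc \<open>cy \<noteq> ce\<close> unfolding T'_def by auto
  from transversal_swap[OF latin T' mem(1,2) rcd ye(2) y(3) ae(4) z this refl]
  show False
    using none mem(3) e rc rd by auto
qed

section \<open>Arbitrary entries\<close>

theorem theorem2p10: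
  fixes n :: nat and S :: "'a set" and L :: "nat \<Rightarrow> nat \<Rightarrow> 'a"
  assumes "latin_square n S L"
    and "n \<ge> 5"
    and "\<exists>T. transversal n S L T"
  shows "\<forall>e\<in>entries n L. \<exists>C. k_cover n S L (n + 1) C \<and> minimal_cover n S L C \<and> e \<in> C"
proof
  fix e assume "e \<in> entries n L"
  then obtain r c where e: "e = (r, c, L r c)" "r < n" "c < n"
    unfolding entries_def by auto
  obtain T where T: "transversal n S L T"
    using assms(3) by blast
  note in_transversal = minimal_cover_if_in_transversal[OF assms(1) _ assms(2)]
  have "cover n S L T" and TE: "T \<subseteq> entries n L"
    using T transversal_cover unfolding transversal_def by auto
  \<comment> \<open>With entries of \<open>T\<close> taken from the row and the column of
    \<open>e\<close>, both the swap and the trade insert \<open>e\<close> itself.\<close>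
  then obtain c\<^sub>1 s\<^sub>1 r\<^sub>2 s\<^sub>2 where t: "(r, c\<^sub>1, s\<^sub>1) \<in> T" "(r\<^sub>2, c, s\<^sub>2) \<in> T"
    using e unfolding cover_iff by blast
  show "\<exists>C. k_cover n S L (n + 1) C \<and> minimal_cover n S L C \<and> e \<in> C"
  proof (cases "r = r\<^sub>2")
    case True
    then have "e \<in> T"
      using t(2) e mem_entriesD[OF subsetD[OF TE t(2)]] by simp
    then show ?thesis
      using in_transversal T by blast
  next
    case False
    from assms(1) T t False show ?thesis
    proof (cases rule: swap_or_trade)
      case (trade r\<^sub>3 c\<^sub>3 s\<^sub>3)
      show ?thesis
        by (rule in_transversal[OF transversal_trade[OF assms(1) T t trade(1) False trade(2-4)]])
          (use e trade(2) in simp)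
    qed (use e in blast)
  qed
qed

end
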